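(* Let $d\ge 1$ be an integer. The three-body problem and the four-body problem in $\mathbb{R}^d$ with positive masses have no hinged solutions. Explicitly: (1) ($n=3$) Let $m_1,m_2,m_3>0$ and let $(X_1(t),X_2(t),X_3(t))$, $t\in I$, be a solution of the three-body problem in $\mathbb{R}^d$ on a nonempty open interval $I\subset\mathbb{R}$. If two of the three mutual distances $r_{12}(t),r_{13}(t),r_{23}(t)$ are constant on $I$, then the solution is a relative equilibrium, i.e. all three mutual distances are constant on $I$. (2) ($n=4$) Let $m_1,m_2,m_3,m_4>0$ and let $(X_1(t),\dots,X_4(t))$, $t\in I$, be a solution of the four-body problem in $\mathbb{R}^d$ on a nonempty open interval $I\subset\mathbb{R}$. If five of the six mutual distances $r_{ij}(t)$, $1\le i<j\le 4$, are constant on $I$, then the solution is a relative equilibrium, i.e. all six mutual distances are constant on $I$.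
   Context: The $n$-body problem in $\mathbb{R}^d$ with masses $m_1,\dots,m_n>0$ is the system of Newtonian equations (gravitational constant $1$) $$\ddot X_j=\sum_{i\neq j}\frac{m_i\,(X_i-X_j)}{r_{ij}^3},\qquad r_{ij}=|X_i-X_j|,\qquad j=1,\dots,n,$$ for positions $X_j(t)\in\mathbb{R}^d$. A solution on an interval $I$ is a collision-free one: $r_{ij}(t)>0$ for all $i\ne j$ and $t\in I$. A solution is a relative equilibrium if all mutual distances $r_{ij}(t)$ are constant in $t$. A solution is hinged if all but one of the mutual distances are constant and the remaining one is not constant. *)

theory Defs
  imports "HOL-Analysis.Analysis"
begin

(* Bodies are indexed by {1..n}. A configuration path X has body index first, time second;
   the values of m and X at indices outside {1..n} play no role. *)

definition mutual_dist :: "(nat \<Rightarrow> real \<Rightarrow> real ^ 'd) \<Rightarrow> nat \<Rightarrow> nat \<Rightarrow> real \<Rightarrow> real" where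
  "mutual_dist X i j t = norm (X i t - X j t)"

definition pairs :: "nat \<Rightarrow> (nat \<times> nat) set" where
  "pairs n = {(i, j). 1 \<le> i \<and> i < j \<and> j \<le> n}"

definition newton_acceleration ::
    "nat \<Rightarrow> (nat \<Rightarrow> real) \<Rightarrow> (nat \<Rightarrow> real \<Rightarrow> real ^ 'd) \<Rightarrow> nat \<Rightarrow> real \<Rightarrow> real ^ 'd" where
  "newton_acceleration n m X j t =
     (\<Sum>i\<in>{1..n} - {j}. (m i / mutual_dist X i j t ^ 3) *\<^sub>R (X i t - X j t))"

(* V is the velocity. On an open I, "at t within I" is the ordinary two-sided derivative. *)

definition n_body_solution ::
    "nat \<Rightarrow> (nat \<Rightarrow> real) \<Rightarrow> real set \<Rightarrow> (nat \<Rightarrow> real \<Rightarrow> real ^ 'd) \<Rightarrow> bool" where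
  "n_body_solution n m I X \<longleftrightarrow>
     (\<forall>t\<in>I. \<forall>i\<in>{1..n}. \<forall>j\<in>{1..n}. i \<noteq> j \<longrightarrow> mutual_dist X i j t > 0) \<and>
     (\<exists>V. \<forall>j\<in>{1..n}. \<forall>t\<in>I.
        (X j has_vector_derivative V j t) (at t within I) \<and>
        (V j has_vector_derivative newton_acceleration n m X j t) (at t within I))"

definition relative_equilibrium ::
    "nat \<Rightarrow> (nat \<Rightarrow> real) \<Rightarrow> real set \<Rightarrow> (nat \<Rightarrow> real \<Rightarrow> real ^ 'd) \<Rightarrow> bool" where
  "relative_equilibrium n m I X \<longleftrightarrow>
     n_body_solution n m I X \<and> (\<forall>(i, j)\<in>pairs n. mutual_dist X i j constant_on I)"

definition hinged ::
    "nat \<Rightarrow> (nat \<Rightarrow> real) \<Rightarrow> real set \<Rightarrow> (nat \<Rightarrow> real \<Rightarrow> real ^ 'd) \<Rightarrow> bool" where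
  "hinged n m I X \<longleftrightarrow>
     n_body_solution n m I X \<and>
     (\<exists>(k, l)\<in>pairs n.
        \<not> mutual_dist X k l constant_on I \<and>
        (\<forall>(i, j)\<in>pairs n - {(k, l)}. mutual_dist X i j constant_on I))"

end

(* Let 34 be the only pair whose distance r may vary, put S = 1/r^3, and take positions relative
   to body 1. A rigid pair with relative position x satisfies x.x' = 0 and x'.x' = -x.x''; since
   x.x'' is an explicit function of r, one more differentiation gives linear relations between the
   inner products of positions and velocities.
   For n = 4, the relation of the pair 12 has constant coefficients. Differentiating it yields a
   linear dependence between 1, r^2 and S, so either r is constant or r13 = r23 and r14 = r24.
   In that case, weighting the relations of the pairs 13 and 23 with m1 and m2 eliminates the
   rotation of the edge 12, and likewise for 14 and 24. What remains is, as for n = 3, two relations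
   (S - Q) g = ..., (S - P) h = ... with P = 1/r13^3, Q = 1/r14^3, g + h = -r r' and right-hand
   sides that are r' times functions of r. Eliminating g and h gives r' p(r) = 0 for a polynomial
   p with leading coefficient 4PQ, free of masses, so an antiderivative of p is constant
   along r, and r takes finitely many values. *)
theory Submission
  imports Defs
begin

section \<open>Derivatives of inner products and criteria for constancy\<close>

lemma inner_has_real_derivative:
  fixes f g :: "real \<Rightarrow> 'a::real_inner"
  assumes "(f has_vector_derivative f') (at t)" and "(g has_vector_derivative g') (at t)"
  shows "((\<lambda>t. f t \<bullet> g t) has_real_derivative (f' \<bullet> g t + f t \<bullet> g')) (at t)"
proof -
  have "((\<lambda>t. f t \<bullet> g t) has_derivative (\<lambda>h. f t \<bullet> (h *\<^sub>R g') + (h *\<^sub>R f') \<bullet> g t)) (at t)"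
    using assms unfolding has_vector_derivative_def by (rule has_derivative_inner)
  then show ?thesis
    unfolding has_field_derivative_def by (rule has_derivative_eq_rhs) (auto simp: algebra_simps)
qed

lemma derivative_of_constant_on_open:
  fixes f :: "real \<Rightarrow> real"
  assumes "open I" "t \<in> I" and const: "\<And>t. t \<in> I \<Longrightarrow> f t = k"
    and f': "(f has_real_derivative D) (at t)"
  shows "D = 0"
proof -
  have "((\<lambda>_. k) has_real_derivative D) (at t)"
    by (rule has_field_derivative_transform_within_open[OF f' assms(1,2)]) (rule const)
  then show ?thesis by (rule DERIV_unique[OF _ DERIV_const])
qed

text \<open>A nonzero polynomial has finitely many roots, and a continuous function on a connected
  set that takes only finitely many values is constant.\<close>

lemma constant_on_if_poly_eq_0:
  fixes r :: "real \<Rightarrow> real"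
  assumes "is_interval I" "continuous_on I r" "p \<noteq> 0" and "\<And>t. t \<in> I \<Longrightarrow> poly p (r t) = 0"
  shows "r constant_on I"
proof -
  have "finite (r ` I)"
    by (rule finite_subset[OF _ poly_roots_finite[OF \<open>p \<noteq> 0\<close>]]) (use assms(4) in auto)
  then show ?thesis
    using continuous_finite_range_constant assms is_interval_connected by blast
qed

text \<open>The vanishing product is the derivative of \<open>poly p (r t)\<close>, so this
  composite is a constant \<open>k\<close> and \<open>r\<close> stays among the roots of
  \<open>p - [:k:]\<close>. Passing to the antiderivative avoids separating the times with
  \<open>\<rho> t = 0\<close> from the others.\<close>

lemma constant_on_if_poly_mult_derivative_eq_0:
  fixes r :: "real \<Rightarrow> real"
  assumes I: "is_interval I"
    and r': "\<And>t. t \<in> I \<Longrightarrow> (r has_real_derivative \<rho> t) (at t)"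
    and "pderiv p \<noteq> 0" and eq: "\<And>t. t \<in> I \<Longrightarrow> poly (pderiv p) (r t) * \<rho> t = 0"
  shows "r constant_on I"
proof -
  have "((\<lambda>t. poly p (r t)) has_real_derivative 0) (at t within I)" if "t \<in> I" for t
    using DERIV_chain2[OF poly_DERIV r'[OF that], of p] eq[OF that]
    by (metis has_field_derivative_at_within)
  then obtain k where k: "\<And>t. t \<in> I \<Longrightarrow> poly p (r t) = k"
    using has_field_derivative_zero_constant[OF is_interval_convex[OF I]] by metis
  have "p - [:k:] \<noteq> 0" using \<open>pderiv p \<noteq> 0\<close> by auto
  moreover have "continuous_on I r"
    using r' DERIV_isCont continuous_at_imp_continuous_on by blast
  ultimately show ?thesis
    using constant_on_if_poly_eq_0[OF I, of r "p - [:k:]"] k by simp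
qed

section \<open>Elimination of the velocities, leaving a polynomial in the hinge distance\<close>

text \<open>This is minus the derivative with respect to \<open>x\<close> of
  \<open>(- d - x ^ 2) / (2 * x ^ 3) + Q * x ^ 2 / 2\<close>, which is the shape of the varying part
  of the inner product of position and acceleration for a rigid pair with one end on the
  hinge.\<close>

definition hinge_rate :: "real \<Rightarrow> real \<Rightarrow> real \<Rightarrow> real" where
  "hinge_rate Q d x = - Q * x - 1 / (2 * x ^ 2) - 3 * d / (2 * x ^ 4)"

text \<open>Each relation is multiplied by the coefficient of the unknown in the other one, so that
  only the known sum \<open>g + h\<close> survives. Nothing is divided by
  \<open>1 / r t ^ 3 - Q\<close> or \<open>1 / r t ^ 3 - P\<close>, hence zeros of these factors do
  no harm.\<close>

lemma hinge_constant_on: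
  fixes r :: "real \<Rightarrow> real"
  assumes I: "is_interval I"
    and r': "\<And>t. t \<in> I \<Longrightarrow> (r has_real_derivative \<rho> t) (at t)"
    and r: "\<And>t. t \<in> I \<Longrightarrow> r t > 0" and "P \<noteq> 0" "Q \<noteq> 0"
    and eq: "\<And>t. t \<in> I \<Longrightarrow> \<exists>g h. g + h = - r t * \<rho> t \<and>
      2 * ((1 / r t ^ 3 - Q) * g) = \<rho> t * hinge_rate Q d (r t) \<and>
      2 * ((1 / r t ^ 3 - P) * h) = \<rho> t * hinge_rate P (- d) (r t)"
  shows "r constant_on I"
proof (rule constant_on_if_poly_mult_derivative_eq_0[OF I r'])
  \<comment> \<open>An antiderivative of \<open>K / 2\<close>, where \<open>K\<close> is the factor
    of \<open>\<rho> t\<close> that the elimination below produces.\<close>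
  define p where "p = [:0, 0, 0, 1/3, 3/8 * d * (P - Q), 0, - 5/12 * (P + Q), 0, 0, 4/9 * P * Q:]"
  \<comment> \<open>This coefficient is \<open>4 * P * Q\<close>, whatever the value of
    \<open>d\<close>.\<close>
  have "coeff (pderiv p) 8 \<noteq> 0"
    using \<open>P \<noteq> 0\<close> \<open>Q \<noteq> 0\<close> by (simp add: p_def coeff_pderiv eval_nat_numeral)
  then show "pderiv p \<noteq> 0" by auto
  fix t assume t: "t \<in> I"
  define x where "x = r t"
  have x: "x > 0" using r[OF t] by (simp add: x_def)
  obtain g h where gh: "g + h = - x * \<rho> t"
    and g: "2 * ((1 / x ^ 3 - Q) * g) = \<rho> t * hinge_rate Q d x"
    and h: "2 * ((1 / x ^ 3 - P) * h) = \<rho> t * hinge_rate P (- d) x"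
    using eq[OF t] unfolding x_def by blast
  \<comment> \<open>The factor \<open>2 * x ^ 4\<close> clears the denominators of
    \<open>hinge_rate\<close>.\<close>
  have "2 * x ^ 4 * (2 * ((1 / x ^ 3 - Q) * g)) = 4 * x * (1 - Q * x ^ 3) * g"
    using x by (simp add: field_simps power_numeral_reduce)
  moreover have "2 * x ^ 4 * (\<rho> t * hinge_rate Q d x)
      = \<rho> t * (- 2 * Q * x ^ 5 - x ^ 2 - 3 * d)"
    using x by (simp add: hinge_rate_def field_simps power_numeral_reduce)
  ultimately have g': "4 * x * (1 - Q * x ^ 3) * g = \<rho> t * (- 2 * Q * x ^ 5 - x ^ 2 - 3 * d)"
    using g by metis
  have "2 * x ^ 4 * (2 * ((1 / x ^ 3 - P) * h)) = 4 * x * (1 - P * x ^ 3) * h"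
    using x by (simp add: field_simps power_numeral_reduce)
  moreover have "2 * x ^ 4 * (\<rho> t * hinge_rate P (- d) x)
      = \<rho> t * (- 2 * P * x ^ 5 - x ^ 2 + 3 * d)"
    using x by (simp add: hinge_rate_def field_simps power_numeral_reduce)
  ultimately have h': "4 * x * (1 - P * x ^ 3) * h = \<rho> t * (- 2 * P * x ^ 5 - x ^ 2 + 3 * d)"
    using h by metis
  define K where "K = 8 * P * Q * x ^ 8 - 5 * (P + Q) * x ^ 5 + 3 * d * (P - Q) * x ^ 3 + 2 * x ^ 2"
  have "4 * x * (1 - P * x ^ 3) * (1 - Q * x ^ 3) * (g + h)
      = (1 - P * x ^ 3) * (4 * x * (1 - Q * x ^ 3) * g) + (1 - Q * x ^ 3) * (4 * x * (1 - P * x ^ 3) * h)"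
    by algebra
  also have "\<dots> = (1 - P * x ^ 3) * (\<rho> t * (- 2 * Q * x ^ 5 - x ^ 2 - 3 * d))
      + (1 - Q * x ^ 3) * (\<rho> t * (- 2 * P * x ^ 5 - x ^ 2 + 3 * d))"
    unfolding g' h' ..
  finally have "K * \<rho> t = 0"
    unfolding gh by (simp add: K_def algebra_simps power_numeral_reduce)
  moreover have "poly (pderiv p) x = K / 2"
    by (simp add: K_def p_def pderiv_pCons field_simps power_numeral_reduce)
  ultimately show "poly (pderiv p) (r t) * \<rho> t = 0" by (auto simp: x_def[symmetric])
qed

section \<open>Differential relations for a rigid pair\<close>

text \<open>Repeated differentiation of the constant squared norm. The derivative of
  \<open>x t \<bullet> x2 t\<close> enters the third relation as a hypothesis, so no third
  derivative of \<open>x\<close> is needed: in the applications this product is an explicit function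
  of the distances.\<close>

lemma constant_norm_derivatives:
  fixes x :: "real \<Rightarrow> 'a::real_inner"
  assumes I: "open I"
    and x': "\<And>t. t \<in> I \<Longrightarrow> (x has_vector_derivative x1 t) (at t)"
    and x'': "\<And>t. t \<in> I \<Longrightarrow> (x1 has_vector_derivative x2 t) (at t)"
    and const: "\<And>t. t \<in> I \<Longrightarrow> norm (x t) = k" and t: "t \<in> I"
  shows "x t \<bullet> x1 t = 0"
    and "x1 t \<bullet> x1 t + x t \<bullet> x2 t = 0"
    and "((\<lambda>t. x t \<bullet> x2 t) has_real_derivative e) (at t) \<Longrightarrow> 2 * (x1 t \<bullet> x2 t) + e = 0"
proof -
  have "x t \<bullet> x t = k\<^sup>2" if "t \<in> I" for t
    using const[OF that] by (simp add: dot_square_norm)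
  then have 1: "x t \<bullet> x1 t = 0" if "t \<in> I" for t
    using derivative_of_constant_on_open[OF I that _ inner_has_real_derivative[OF x' x'], of "k\<^sup>2"] that
    by (simp add: inner_commute)
  show "x t \<bullet> x1 t = 0" using 1[OF t] .
  have 2: "x1 t \<bullet> x1 t + x t \<bullet> x2 t = 0" if "t \<in> I" for t
    using derivative_of_constant_on_open[OF I that _ inner_has_real_derivative[OF x' x''], of 0] that 1
    by simp
  show "x1 t \<bullet> x1 t + x t \<bullet> x2 t = 0" using 2[OF t] .
  assume "((\<lambda>t. x t \<bullet> x2 t) has_real_derivative e) (at t)"
  then have "((\<lambda>t. x1 t \<bullet> x1 t + x t \<bullet> x2 t) has_real_derivative
      (x2 t \<bullet> x1 t + x1 t \<bullet> x2 t) + e) (at t)"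
    by (intro DERIV_add inner_has_real_derivative x'' t)
  from derivative_of_constant_on_open[OF I t _ this] 2
  show "2 * (x1 t \<bullet> x2 t) + e = 0" by (simp add: inner_commute)
qed

lemma norm_has_real_derivative:
  fixes x :: "real \<Rightarrow> 'a::real_inner"
  assumes "(x has_vector_derivative x') (at t)" "x t \<noteq> 0"
  shows "((\<lambda>t. norm (x t)) has_real_derivative (x t \<bullet> x') / norm (x t)) (at t)"
proof -
  have "((\<lambda>t. sqrt (x t \<bullet> x t)) has_real_derivative
      (inverse (sqrt (x t \<bullet> x t)) / 2) * (x' \<bullet> x t + x t \<bullet> x')) (at t)"
    using assms by (intro DERIV_chain2[OF DERIV_real_sqrt] inner_has_real_derivative) auto
  then show ?thesis
    unfolding norm_eq_sqrt_inner
    by (rule DERIV_cong) (simp add: inner_commute[of x'] field_simps)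
qed

text \<open>The third relation for a rigid pair with one end on the hinge. In the applications
  \<open>C\<close> collects the constant terms, \<open>M\<close> is the mass at the other end of the
  hinge, and \<open>d\<close> is the difference of the squared distances from the origin body to the
  two ends.\<close>

lemma hinge_pair:
  fixes x :: "real \<Rightarrow> 'a::real_inner" and r :: "real \<Rightarrow> real"
  assumes I: "open I"
    and x': "\<And>t. t \<in> I \<Longrightarrow> (x has_vector_derivative x1 t) (at t)"
    and x'': "\<And>t. t \<in> I \<Longrightarrow> (x1 has_vector_derivative x2 t) (at t)"
    and const: "\<And>t. t \<in> I \<Longrightarrow> norm (x t) = k"
    and r': "\<And>t. t \<in> I \<Longrightarrow> (r has_real_derivative \<rho> t) (at t)"
    and r: "\<And>t. t \<in> I \<Longrightarrow> r t > 0"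
    and eq: "\<And>t. t \<in> I \<Longrightarrow>
      x t \<bullet> x2 t = C + M * ((- d - r t ^ 2) / (2 * r t ^ 3) + Q * r t ^ 2 / 2)"
    and t: "t \<in> I"
  shows "2 * (x1 t \<bullet> x2 t) = M * (\<rho> t * hinge_rate Q d (r t))"
proof -
  define D where "D = - (M * (\<rho> t * hinge_rate Q d (r t)))"
  have "r t \<noteq> 0" using r[OF t] by simp
  have "((\<lambda>t. C + M * ((- d - r t ^ 2) / (2 * r t ^ 3) + Q * r t ^ 2 / 2)) has_real_derivative
      M * (((- (2 * r t * \<rho> t)) * (2 * r t ^ 3) - (- d - r t ^ 2) * (2 * (3 * r t ^ 2 * \<rho> t)))
        / ((2 * r t ^ 3) * (2 * r t ^ 3)) + Q * (2 * r t * \<rho> t) / 2)) (at t)"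
    using \<open>r t \<noteq> 0\<close> by (auto intro!: derivative_eq_intros r'[OF t])
  then have "((\<lambda>t. C + M * ((- d - r t ^ 2) / (2 * r t ^ 3) + Q * r t ^ 2 / 2)) has_real_derivative D) (at t)"
    by (rule DERIV_cong)
      (use \<open>r t \<noteq> 0\<close> in \<open>simp add: D_def hinge_rate_def field_simps power_numeral_reduce\<close>)
  then have "((\<lambda>t. x t \<bullet> x2 t) has_real_derivative D) (at t)"
    by (rule has_field_derivative_transform_within_open[OF _ I t]) (simp add: eq)
  from constant_norm_derivatives(3)[OF I x' x'' const t this]
  show ?thesis unfolding D_def by linarith
qed

section \<open>The three-body problem in relative coordinates\<close>

text \<open>Here \<open>v\<close> and \<open>w\<close> are the positions of bodies 2 and 3 relative
  to body 1. As \<open>v1\<close> is orthogonal to \<open>v\<close>, only the multiple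
  \<open>1 / r^3 - Q\<close> of \<open>v1 \<bullet> w\<close> survives in
  \<open>v1 \<bullet> v2\<close>, and symmetrically for \<open>w\<close>. These are the two
  relations that \<open>hinge_constant_on\<close> eliminates.\<close>

lemma three_body_hinge_constant_on:
  fixes v w v1 w1 v2 w2 :: "real \<Rightarrow> 'a::real_inner"
  assumes I: "open I" "is_interval I"
    and v': "\<And>t. t \<in> I \<Longrightarrow> (v has_vector_derivative v1 t) (at t)"
    and v'': "\<And>t. t \<in> I \<Longrightarrow> (v1 has_vector_derivative v2 t) (at t)"
    and w': "\<And>t. t \<in> I \<Longrightarrow> (w has_vector_derivative w1 t) (at t)"
    and w'': "\<And>t. t \<in> I \<Longrightarrow> (w1 has_vector_derivative w2 t) (at t)"
    and b: "\<And>t. t \<in> I \<Longrightarrow> norm (v t) = b" "b > 0"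
    and c: "\<And>t. t \<in> I \<Longrightarrow> norm (w t) = c" "c > 0"
    and vw: "\<And>t. t \<in> I \<Longrightarrow> v t \<noteq> w t"
    and m: "m2 > 0" "m3 > 0"
    and v2: "\<And>t. t \<in> I \<Longrightarrow> v2 t = - ((m1 + m2) / b ^ 3) *\<^sub>R v t
      + m3 *\<^sub>R ((1 / norm (v t - w t) ^ 3) *\<^sub>R (w t - v t) - (1 / c ^ 3) *\<^sub>R w t)"
    and w2: "\<And>t. t \<in> I \<Longrightarrow> w2 t = - ((m1 + m3) / c ^ 3) *\<^sub>R w t
      + m2 *\<^sub>R ((1 / norm (v t - w t) ^ 3) *\<^sub>R (v t - w t) - (1 / b ^ 3) *\<^sub>R v t)"
  shows "(\<lambda>t. norm (v t - w t)) constant_on I"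
proof -
  define r where "r t = norm (v t - w t)" for t
  define \<rho> where "\<rho> t = ((v t - w t) \<bullet> (v1 t - w1 t)) / r t" for t
  define P where "P = 1 / b ^ 3"
  define Q where "Q = 1 / c ^ 3"
  define d where "d = b ^ 2 - c ^ 2"
  have r_pos: "r t > 0" if "t \<in> I" for t using vw[OF that] by (simp add: r_def)
  have r': "(r has_real_derivative \<rho> t) (at t)" if "t \<in> I" for t
    unfolding r_def \<rho>_def
    by (rule norm_has_real_derivative) (use that vw in \<open>auto intro!: derivative_intros v' w'\<close>)
  have vv: "v t \<bullet> v t = b ^ 2" and ww: "w t \<bullet> w t = c ^ 2" if "t \<in> I" for t
    using b(1)[OF that] c(1)[OF that] by (simp_all add: dot_square_norm)
  have c_eq: "v t \<bullet> w t = (b ^ 2 + c ^ 2 - r t ^ 2) / 2" if "t \<in> I" for t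
    using vv[OF that] ww[OF that]
    by (simp add: r_def power2_norm_eq_inner inner_diff_left inner_diff_right inner_commute)
  have expv: "z \<bullet> v2 t = - ((m1 + m2) * P * (z \<bullet> v t))
      + m3 * (1 / r t ^ 3 * (z \<bullet> w t - z \<bullet> v t) - Q * (z \<bullet> w t))" if "t \<in> I" for z t
    using that by (simp add: v2 r_def P_def Q_def inner_diff_right inner_add_right)
  have expw: "z \<bullet> w2 t = - ((m1 + m3) * Q * (z \<bullet> w t))
      + m2 * (1 / r t ^ 3 * (z \<bullet> v t - z \<bullet> w t) - P * (z \<bullet> v t))" if "t \<in> I" for z t
    using that by (simp add: w2 r_def P_def Q_def inner_diff_right inner_add_right)
  have "r constant_on I"
  proof (rule hinge_constant_on[OF I(2) r' r_pos, of P Q d])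
    show "P \<noteq> 0" "Q \<noteq> 0" using b c by (simp_all add: P_def Q_def)
    fix t assume t: "t \<in> I"
    have "r t > 0" using r_pos t .
    have vv1: "v t \<bullet> v1 t = 0" and ww1: "w t \<bullet> w1 t = 0"
      using constant_norm_derivatives(1)[OF I(1) v' v'' b(1) t]
        constant_norm_derivatives(1)[OF I(1) w' w'' c(1) t] by auto
    have "2 * (v1 t \<bullet> v2 t) = m3 * (\<rho> t * hinge_rate Q d (r t))"
    proof (rule hinge_pair[OF I(1) v' v'' b(1) r' r_pos _ t])
      show "v t \<bullet> v2 t = (- (m1 + m2) * P * b ^ 2 - m3 * Q * (b ^ 2 + c ^ 2) / 2)
          + m3 * ((- d - r t ^ 2) / (2 * r t ^ 3) + Q * r t ^ 2 / 2)" if "t \<in> I" for t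
        using that r_pos[OF that]
        by (simp add: expv vv c_eq d_def field_simps)
    qed
    moreover have "v1 t \<bullet> v2 t = m3 * ((1 / r t ^ 3 - Q) * (v1 t \<bullet> w t))"
      using t vv1 by (simp add: expv inner_commute algebra_simps)
    \<comment> \<open>Both sides carry the factor \<open>m3\<close>; cancelling it makes the
      relation free of masses.\<close>
    ultimately have g: "2 * ((1 / r t ^ 3 - Q) * (v1 t \<bullet> w t))
        = \<rho> t * hinge_rate Q d (r t)"
      using m by simp
    have "2 * (w1 t \<bullet> w2 t) = m2 * (\<rho> t * hinge_rate P (- d) (r t))"
    proof (rule hinge_pair[OF I(1) w' w'' c(1) r' r_pos _ t])
      show "w t \<bullet> w2 t = (- (m1 + m3) * Q * c ^ 2 - m2 * P * (b ^ 2 + c ^ 2) / 2)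
          + m2 * ((- (- d) - r t ^ 2) / (2 * r t ^ 3) + P * r t ^ 2 / 2)" if "t \<in> I" for t
        using that r_pos[OF that]
        by (simp add: expw ww c_eq inner_commute[of "w t" "v t"] d_def field_simps)
    qed
    moreover have "w1 t \<bullet> w2 t = m2 * ((1 / r t ^ 3 - P) * (w1 t \<bullet> v t))"
      using t ww1 by (simp add: expw inner_commute algebra_simps)
    ultimately have h: "2 * ((1 / r t ^ 3 - P) * (w1 t \<bullet> v t))
        = \<rho> t * hinge_rate P (- d) (r t)"
      using m by simp
    \<comment> \<open>The left side is the derivative of \<open>v t \<bullet> w t\<close>, which
      equals \<open>(b ^ 2 + c ^ 2 - r t ^ 2) / 2\<close>.\<close>
    have "v1 t \<bullet> w t + w1 t \<bullet> v t = - r t * \<rho> t"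
      using \<open>r t > 0\<close> vv1 ww1
      by (simp add: \<rho>_def inner_diff_left inner_diff_right inner_commute)
    with g h show "\<exists>g h. g + h = - r t * \<rho> t \<and>
      2 * ((1 / r t ^ 3 - Q) * g) = \<rho> t * hinge_rate Q d (r t) \<and>
      2 * ((1 / r t ^ 3 - P) * h) = \<rho> t * hinge_rate P (- d) (r t)"
      by blast
  qed
  then show ?thesis unfolding r_def .
qed

section \<open>The four-body problem in relative coordinates\<close>

text \<open>Here u, v, w are the positions of bodies 2, 3, 4 relative to body 1, and a, b, c, e, f stand
  for r12, r13, r14, r23, r24. The distances and their inverse cubes are parameters, so that
  exchanging bodies 3 and 4 is an interpretation of the locale in itself.\<close>

locale four_body_hinge =
  fixes I :: "real set" and u v w u1 v1 w1 u2 v2 w2 :: "real \<Rightarrow> 'a::real_inner"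
    and r :: "real \<Rightarrow> real" and m1 m2 m3 m4 a b c e f A B C E F :: real
  assumes I: "open I" "is_interval I"
    and u': "\<And>t. t \<in> I \<Longrightarrow> (u has_vector_derivative u1 t) (at t)"
    and u'': "\<And>t. t \<in> I \<Longrightarrow> (u1 has_vector_derivative u2 t) (at t)"
    and v': "\<And>t. t \<in> I \<Longrightarrow> (v has_vector_derivative v1 t) (at t)"
    and v'': "\<And>t. t \<in> I \<Longrightarrow> (v1 has_vector_derivative v2 t) (at t)"
    and w': "\<And>t. t \<in> I \<Longrightarrow> (w has_vector_derivative w1 t) (at t)"
    and w'': "\<And>t. t \<in> I \<Longrightarrow> (w1 has_vector_derivative w2 t) (at t)"
    and norms: "\<And>t. t \<in> I \<Longrightarrow> norm (u t) = a" "\<And>t. t \<in> I \<Longrightarrow> norm (v t) = b"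
      "\<And>t. t \<in> I \<Longrightarrow> norm (w t) = c" "\<And>t. t \<in> I \<Longrightarrow> norm (v t - u t) = e"
      "\<And>t. t \<in> I \<Longrightarrow> norm (w t - u t) = f"
    and pos: "a > 0" "b > 0" "c > 0" "e > 0" "f > 0"
    and r: "\<And>t. t \<in> I \<Longrightarrow> r t = norm (v t - w t)"
    and r_pos: "\<And>t. t \<in> I \<Longrightarrow> r t > 0"
    and m: "m1 > 0" "m2 > 0" "m3 > 0" "m4 > 0"
    and inv_cubes: "A = 1 / a ^ 3" "B = 1 / b ^ 3" "C = 1 / c ^ 3" "E = 1 / e ^ 3" "F = 1 / f ^ 3"
    and u2: "\<And>t. t \<in> I \<Longrightarrow> u2 t = - ((m1 + m2) * A) *\<^sub>R u t
      + m3 *\<^sub>R (E *\<^sub>R (v t - u t) - B *\<^sub>R v t) + m4 *\<^sub>R (F *\<^sub>R (w t - u t) - C *\<^sub>R w t)"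
    and v2: "\<And>t. t \<in> I \<Longrightarrow> v2 t = - ((m1 + m3) * B) *\<^sub>R v t
      + m2 *\<^sub>R (E *\<^sub>R (u t - v t) - A *\<^sub>R u t)
      + m4 *\<^sub>R ((1 / r t ^ 3) *\<^sub>R (w t - v t) - C *\<^sub>R w t)"
    and w2: "\<And>t. t \<in> I \<Longrightarrow> w2 t = - ((m1 + m4) * C) *\<^sub>R w t
      + m2 *\<^sub>R (F *\<^sub>R (u t - w t) - A *\<^sub>R u t)
      + m3 *\<^sub>R ((1 / r t ^ 3) *\<^sub>R (v t - w t) - B *\<^sub>R v t)"
begin

lemma swap: "four_body_hinge I u w v u1 w1 v1 u2 w2 v2 r m1 m2 m4 m3 a c b f e A C B F E"
  by unfold_locales
    (use I u' u'' v' v'' w' w'' norms pos r r_pos m inv_cubes u2 v2 w2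
      in \<open>auto simp: norm_minus_commute add_ac\<close>)

definition \<rho> :: "real \<Rightarrow> real" where
  "\<rho> t = ((v t - w t) \<bullet> (v1 t - w1 t)) / r t"

lemma r': assumes t: "t \<in> I" shows "(r has_real_derivative \<rho> t) (at t)"
proof -
  have "((\<lambda>t. norm (v t - w t)) has_real_derivative \<rho> t) (at t)"
    unfolding \<rho>_def r[OF t]
    by (rule norm_has_real_derivative)
      (use t r[of t] r_pos[of t] in \<open>auto intro!: derivative_intros v' w'\<close>)
  then show ?thesis
    by (rule has_field_derivative_transform_within_open[OF _ I(1) t]) (simp add: r)
qed

lemma vu': "t \<in> I \<Longrightarrow> ((\<lambda>t. v t - u t) has_vector_derivative (v1 t - u1 t)) (at t)"
  and vu'': "t \<in> I \<Longrightarrow> ((\<lambda>t. v1 t - u1 t) has_vector_derivative (v2 t - u2 t)) (at t)"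
  by (auto intro!: derivative_intros u' u'' v' v'')

text \<open>Polarization of the six distances. Only the last entry of the Gram matrix varies, and it
  does so through \<open>r t\<close> alone.\<close>

lemma inner_products:
  assumes "t \<in> I"
  shows "u t \<bullet> u t = a ^ 2" "v t \<bullet> v t = b ^ 2" "w t \<bullet> w t = c ^ 2"
    and "u t \<bullet> v t = (a ^ 2 + b ^ 2 - e ^ 2) / 2" "u t \<bullet> w t = (a ^ 2 + c ^ 2 - f ^ 2) / 2"
    and "v t \<bullet> w t = (b ^ 2 + c ^ 2 - r t ^ 2) / 2"
proof -
  show *: "u t \<bullet> u t = a ^ 2" "v t \<bullet> v t = b ^ 2" "w t \<bullet> w t = c ^ 2"
    using norms[OF assms] by (simp_all add: dot_square_norm)
  have "(v t - u t) \<bullet> (v t - u t) = e ^ 2" "(w t - u t) \<bullet> (w t - u t) = f ^ 2"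
    "(v t - w t) \<bullet> (v t - w t) = r t ^ 2"
    using norms[OF assms] r[OF assms] by (simp_all add: dot_square_norm)
  then show "u t \<bullet> v t = (a ^ 2 + b ^ 2 - e ^ 2) / 2" "u t \<bullet> w t = (a ^ 2 + c ^ 2 - f ^ 2) / 2"
    "v t \<bullet> w t = (b ^ 2 + c ^ 2 - r t ^ 2) / 2"
    using * by (simp_all add: inner_diff_left inner_diff_right inner_commute)
qed

lemma velocity_inner_products:
  assumes t: "t \<in> I"
  shows "u t \<bullet> u1 t = 0" "v t \<bullet> v1 t = 0" "w t \<bullet> w1 t = 0" "u t \<bullet> v1 t = - (u1 t \<bullet> v t)"
    and "v1 t \<bullet> w t + w1 t \<bullet> v t = - r t * \<rho> t"
proof -
  show *: "u t \<bullet> u1 t = 0" "v t \<bullet> v1 t = 0" "w t \<bullet> w1 t = 0"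
    using constant_norm_derivatives(1)[OF I(1) u' u'' norms(1) t]
      constant_norm_derivatives(1)[OF I(1) v' v'' norms(2) t]
      constant_norm_derivatives(1)[OF I(1) w' w'' norms(3) t] by auto
  show "u t \<bullet> v1 t = - (u1 t \<bullet> v t)"
    using constant_norm_derivatives(1)[OF I(1) vu' vu'' norms(4) t] *
    by (simp add: inner_diff_left inner_diff_right inner_commute)
  show "v1 t \<bullet> w t + w1 t \<bullet> v t = - r t * \<rho> t"
    using r_pos[OF t] * by (simp add: \<rho>_def inner_diff_left inner_diff_right inner_commute)
qed

lemma inner_u2: "t \<in> I \<Longrightarrow> z \<bullet> u2 t = - ((m1 + m2) * A * (z \<bullet> u t))
      + m3 * (E * (z \<bullet> v t - z \<bullet> u t) - B * (z \<bullet> v t)) + m4 * (F * (z \<bullet> w t - z \<bullet> u t) - C * (z \<bullet> w t))"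
  and inner_v2: "t \<in> I \<Longrightarrow> z \<bullet> v2 t = - ((m1 + m3) * B * (z \<bullet> v t))
      + m2 * (E * (z \<bullet> u t - z \<bullet> v t) - A * (z \<bullet> u t))
      + m4 * (1 / r t ^ 3 * (z \<bullet> w t - z \<bullet> v t) - C * (z \<bullet> w t))"
  by (simp_all add: u2 v2 inner_diff_right inner_add_right)

text \<open>The acceleration of the edge 12 does not involve \<open>r\<close>, and all inner
  products of \<open>u\<close> with \<open>u\<close>, \<open>v\<close>, \<open>w\<close> are
  constant. So \<open>u t \<bullet> u2 t\<close> is constant and \<open>u1 t \<bullet> u2 t\<close>
  vanishes.\<close>

lemma constant_speed_relation:
  assumes t: "t \<in> I"
  shows "m3 * (E - B) * (u1 t \<bullet> v t) + m4 * (F - C) * (u1 t \<bullet> w t) = 0"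
proof -
  define k where "k = u t \<bullet> u2 t"
  have "u s \<bullet> u2 s = k" if "s \<in> I" for s
    using that t by (simp add: k_def inner_u2 inner_products)
  then have "((\<lambda>t. u t \<bullet> u2 t) has_real_derivative 0) (at t)"
    by (intro has_field_derivative_transform_within_open[OF DERIV_const I(1) t]) simp
  from constant_norm_derivatives(3)[OF I(1) u' u'' norms(1) t this]
  show ?thesis
    using t velocity_inner_products(1)[OF t]
    by (simp add: inner_u2 inner_commute algebra_simps)
qed

text \<open>Since \<open>u t \<bullet> v t\<close> is constant, its second derivative is zero, which
  expresses \<open>u1 t \<bullet> v1 t\<close> through positions and accelerations. No velocity
  remains in the derivative.\<close>

lemma inner_derivative:
  assumes t: "t \<in> I"
  shows "((\<lambda>t. u1 t \<bullet> v t) has_real_derivative (u2 t \<bullet> v t - u t \<bullet> v2 t) / 2) (at t)"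
proof (rule DERIV_cong[OF inner_has_real_derivative[OF u''[OF t] v'[OF t]]])
  have "(v1 t - u1 t) \<bullet> (v1 t - u1 t) + (v t - u t) \<bullet> (v2 t - u2 t) = 0"
    by (rule constant_norm_derivatives(2)[OF I(1) vu' vu'' norms(4) t])
  moreover have "u1 t \<bullet> u1 t + u t \<bullet> u2 t = 0"
    by (rule constant_norm_derivatives(2)[OF I(1) u' u'' norms(1) t])
  moreover have "v1 t \<bullet> v1 t + v t \<bullet> v2 t = 0"
    by (rule constant_norm_derivatives(2)[OF I(1) v' v'' norms(2) t])
  ultimately show "u2 t \<bullet> v t + u1 t \<bullet> v1 t = (u2 t \<bullet> v t - u t \<bullet> v2 t) / 2"
    by (simp add: inner_diff_left inner_diff_right inner_commute)
qed

text \<open>The factor of \<open>1 / r t ^ 3\<close> comes from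
  \<open>u t \<bullet> (w t - v t)\<close>, the inner product of the edges 12 and 34. The constant
  \<open>X\<close> stays anonymous, since later only the varying terms are compared.\<close>

lemma torque:
  "\<exists>X. \<forall>t\<in>I. u2 t \<bullet> v t - u t \<bullet> v2 t = X +
    m4 * ((F - C) * ((b ^ 2 + c ^ 2 - r t ^ 2) / 2) - 1 / r t ^ 3 * ((c ^ 2 - f ^ 2 - b ^ 2 + e ^ 2) / 2))"
proof -
  define p where "p = (a ^ 2 + b ^ 2 - e ^ 2) / 2"
  define q where "q = (a ^ 2 + c ^ 2 - f ^ 2) / 2"
  define k where "k t = (b ^ 2 + c ^ 2 - r t ^ 2) / 2" for t
  define X where "X = - (m1 + m2) * A * p + m3 * (E * (b ^ 2 - p) - B * b ^ 2)
      - m4 * F * p + m4 * C * q + (m1 + m3) * B * p - m2 * (E * (a ^ 2 - p) - A * a ^ 2)"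
  have \<delta>: "(c ^ 2 - f ^ 2 - b ^ 2 + e ^ 2) / 2 = q - p" by (simp add: p_def q_def field_simps)
  have "v t \<bullet> u2 t - u t \<bullet> v2 t = X +
      m4 * ((F - C) * k t - 1 / r t ^ 3 * (q - p))" if "t \<in> I" for t
    using that by (simp add: X_def inner_u2 inner_v2 inner_products inner_commute[of "v t" "u t"]
      p_def[symmetric] q_def[symmetric] k_def[symmetric] algebra_simps)
  then show ?thesis unfolding \<delta> k_def by (auto simp: inner_commute)
qed

text \<open>Differentiating \<open>constant_speed_relation\<close> and inserting
  \<open>torque\<close> for both ends of the hinge gives a polynomial equation for
  \<open>r t\<close>. Either it is nontrivial and \<open>r\<close> is constant, or its vanishing
  coefficients force both isosceles conditions.\<close>

lemma constant_or_isosceles: "r constant_on I \<or> b = e \<and> c = f"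
proof -
  interpret swap: four_body_hinge I u w v u1 w1 v1 u2 w2 v2 r m1 m2 m4 m3 a c b f e A C B F E
    by (rule swap)
  define \<kappa> where "\<kappa> = E - B"
  define \<mu> where "\<mu> = F - C"
  define \<delta> where "\<delta> = (c ^ 2 - f ^ 2 - b ^ 2 + e ^ 2) / 2"
  have \<delta>': "(b ^ 2 - e ^ 2 - c ^ 2 + f ^ 2) / 2 = - \<delta>" by (simp add: \<delta>_def field_simps)
  obtain X where X: "\<And>t. t \<in> I \<Longrightarrow> u2 t \<bullet> v t - u t \<bullet> v2 t
      = X + m4 * (\<mu> * ((b ^ 2 + c ^ 2 - r t ^ 2) / 2) - 1 / r t ^ 3 * \<delta>)"
    using torque unfolding \<mu>_def \<delta>_def by blast
  \<comment> \<open>Exchanging bodies 3 and 4 reverses the sign of \<open>\<delta>\<close>.\<close>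
  obtain Y where Y: "\<And>t. t \<in> I \<Longrightarrow> u2 t \<bullet> w t - u t \<bullet> w2 t
      = Y + m3 * (\<kappa> * ((c ^ 2 + b ^ 2 - r t ^ 2) / 2) - 1 / r t ^ 3 * (- \<delta>))"
    using swap.torque unfolding \<kappa>_def \<delta>' by blast
  define L0 where "L0 = m3 * \<kappa> * X + m4 * \<mu> * Y + m3 * m4 * \<kappa> * \<mu> * (b ^ 2 + c ^ 2)"
  define L1 where "L1 = m3 * m4 * \<kappa> * \<mu>"
  define L2 where "L2 = m3 * m4 * \<delta> * (\<mu> - \<kappa>)"
  \<comment> \<open>The derivative of the relation times \<open>2 * r t ^ 3\<close>. The anonymous
    constants \<open>X\<close> and \<open>Y\<close> enter only \<open>L0\<close>, which the case
    \<open>p = 0\<close> does not consult.\<close>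
  define p where "p = [:L2, 0, 0, L0, 0, - L1:]"
  have p: "poly p (r t) = 0" if t: "t \<in> I" for t
  proof -
    have "((\<lambda>t. m3 * \<kappa> * (u1 t \<bullet> v t) + m4 * \<mu> * (u1 t \<bullet> w t)) has_real_derivative
        m3 * \<kappa> * ((u2 t \<bullet> v t - u t \<bullet> v2 t) / 2) + m4 * \<mu> * ((u2 t \<bullet> w t - u t \<bullet> w2 t) / 2)) (at t)"
      by (intro DERIV_add DERIV_cmult inner_derivative[OF t] swap.inner_derivative[OF t])
    from derivative_of_constant_on_open[OF I(1) t _ this, of 0]
    have "m3 * \<kappa> * ((u2 t \<bullet> v t - u t \<bullet> v2 t) / 2) + m4 * \<mu> * ((u2 t \<bullet> w t - u t \<bullet> w2 t) / 2) = 0"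
      using constant_speed_relation unfolding \<kappa>_def \<mu>_def by blast
    moreover have "poly p (r t) = 2 * r t ^ 3 *
      (m3 * \<kappa> * ((u2 t \<bullet> v t - u t \<bullet> v2 t) / 2) + m4 * \<mu> * ((u2 t \<bullet> w t - u t \<bullet> w2 t) / 2))"
      using r_pos[OF t] unfolding X[OF t] Y[OF t]
      by (simp add: p_def L0_def L1_def L2_def field_simps power_numeral_reduce)
    ultimately show ?thesis by simp
  qed
  have eqI: "x = y" if "x > 0" "y > 0" "1 / x ^ 3 - 1 / y ^ 3 = 0" for x y :: real
    using that power_eq_iff_eq_base[of 3 x y] by simp
  show ?thesis
  proof (cases "p = 0")
    case True
    then have *: "\<kappa> = 0 \<or> \<mu> = 0" "\<delta> = 0 \<or> \<mu> = \<kappa>"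
      using m by (simp_all add: p_def L1_def L2_def)
    have \<kappa>: "\<kappa> = 0 \<longleftrightarrow> b = e" and \<mu>: "\<mu> = 0 \<longleftrightarrow> c = f"
      using pos eqI[of e b] eqI[of f c] by (auto simp: \<kappa>_def \<mu>_def inv_cubes)
    \<comment> \<open>If \<open>\<delta> = 0\<close>, then
      \<open>c ^ 2 - f ^ 2 = b ^ 2 - e ^ 2\<close>. If \<open>\<delta>\<close> is nonzero, then
      \<open>\<mu> = \<kappa>\<close>, and both are zero because one of them is.\<close>
    have "\<delta> = 0 \<Longrightarrow> b = e \<longleftrightarrow> c = f"
      using pos by (auto simp: \<delta>_def)
    with * \<kappa> \<mu> show ?thesis by metis
  next
    case False
    have "continuous_on I r"
      using r' DERIV_isCont continuous_at_imp_continuous_on by blast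
    then show ?thesis using constant_on_if_poly_eq_0[of I r p, OF I(2) _ False p] by blast
  qed
qed

text \<open>The weights m1 and m2 on the relations of the pairs 13 and 23 cancel the terms that stem from
  the attraction along the edge 12.\<close>

lemma weighted_balance:
  assumes iso: "b = e" "c = f" and t: "t \<in> I"
  shows "2 * ((1 / r t ^ 3 - C) * (v1 t \<bullet> w t + m2 / (m1 + m2) * (u1 t \<bullet> v t - u1 t \<bullet> w t)))
    = \<rho> t * hinge_rate C (b ^ 2 - c ^ 2) (r t)"
proof -
  interpret swap: four_body_hinge I u w v u1 w1 v1 u2 w2 v2 r m1 m2 m4 m3 a c b f e A C B F E
    by (rule swap)
  note vel = velocity_inner_products[OF t] swap.velocity_inner_products[OF t]
  have EF: "E = B" "F = C" using iso by (simp_all add: inv_cubes)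
  define R where "R = \<rho> t * hinge_rate C (b ^ 2 - c ^ 2) (r t)"
  define S where "S = 1 / r t ^ 3"
  define \<alpha> where "\<alpha> = u1 t \<bullet> v t"
  define \<beta> where "\<beta> = u1 t \<bullet> w t"
  define \<gamma> where "\<gamma> = v1 t \<bullet> w t"
  have "2 * (v1 t \<bullet> v2 t) = m4 * R"
    unfolding R_def
  proof (rule hinge_pair[OF I(1) v' v'' norms(2) r' r_pos _ t])
    show "v t \<bullet> v2 t = (- ((m1 + m3) * B * b ^ 2) + m2 * (E * (a ^ 2 / 2 - b ^ 2) - A * (a ^ 2 / 2))
        - m4 * (C * (b ^ 2 + c ^ 2) / 2))
        + m4 * ((- (b ^ 2 - c ^ 2) - r t ^ 2) / (2 * r t ^ 3) + C * r t ^ 2 / 2)" if "t \<in> I" for t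
      using that r_pos[OF that] iso
      by (simp add: inner_v2 inner_products inner_commute[of "v t" "u t"] field_simps)
  qed
  moreover have "v1 t \<bullet> v2 t = m2 * (A - B) * \<alpha> + m4 * ((S - C) * \<gamma>)"
    using t vel EF
    by (simp add: inner_v2 inner_commute \<alpha>_def \<gamma>_def S_def algebra_simps add_divide_distrib diff_divide_distrib)
  ultimately have 1: "2 * (m2 * (A - B) * \<alpha> + m4 * ((S - C) * \<gamma>)) = m4 * R" by simp
  \<comment> \<open>By \<open>b = e\<close> and \<open>c = f\<close>, the product for the pair 23
    varies with \<open>r\<close> exactly as that for 13 does, so the right-hand side is again
    \<open>m4 * R\<close>.\<close>
  have "2 * ((v1 t - u1 t) \<bullet> (v2 t - u2 t)) = m4 * R"
    unfolding R_def
  proof (rule hinge_pair[OF I(1) vu' vu'' norms(4) r' r_pos _ t])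
    show "(v t - u t) \<bullet> (v2 t - u2 t) = (- ((m2 + m3) * B * b ^ 2) + m1 * (A * (a ^ 2 / 2 - a ^ 2) - B * (b ^ 2 - a ^ 2 / 2))
        - m4 * (C * (b ^ 2 + c ^ 2) / 2))
        + m4 * ((- (b ^ 2 - c ^ 2) - r t ^ 2) / (2 * r t ^ 3) + C * r t ^ 2 / 2)" if "t \<in> I" for t
      using that r_pos[OF that] iso EF
      by (simp add: inner_diff_right[of _ "v2 t" "u2 t"] inner_u2 inner_v2)
        (simp add: inner_diff_left inner_products inner_commute[of "v t" "u t"] field_simps)
  qed
  \<comment> \<open>The term \<open>\<gamma> + \<alpha> - \<beta>\<close> is
    \<open>(v1 t - u1 t) \<bullet> (w t - u t)\<close>, the analogue of \<open>\<gamma>\<close> with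
    body 2 as origin.\<close>
  moreover have "(v1 t - u1 t) \<bullet> (v2 t - u2 t) = - m1 * (A - B) * \<alpha> + m4 * ((S - C) * (\<gamma> + \<alpha> - \<beta>))"
    using t vel EF
    by (simp add: inner_diff_right[of _ "v2 t" "u2 t"] inner_u2 inner_v2)
      (simp add: inner_diff_left inner_commute \<alpha>_def \<beta>_def \<gamma>_def S_def algebra_simps add_divide_distrib diff_divide_distrib)
  ultimately have 2: "2 * (- m1 * (A - B) * \<alpha> + m4 * ((S - C) * (\<gamma> + \<alpha> - \<beta>))) = m4 * R" by simp
  have "m4 * (2 * ((S - C) * ((m1 + m2) * \<gamma> + m2 * (\<alpha> - \<beta>))))
    = m1 * (2 * (m2 * (A - B) * \<alpha> + m4 * ((S - C) * \<gamma>)))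
      + m2 * (2 * (- m1 * (A - B) * \<alpha> + m4 * ((S - C) * (\<gamma> + \<alpha> - \<beta>))))"
    by (simp add: algebra_simps)
  also have "\<dots> = m4 * ((m1 + m2) * R)" unfolding 1 2 by (simp add: algebra_simps)
  finally have "2 * ((S - C) * ((m1 + m2) * \<gamma> + m2 * (\<alpha> - \<beta>))) = (m1 + m2) * R"
    using m by simp
  then have "2 * ((S - C) * (\<gamma> + m2 / (m1 + m2) * (\<alpha> - \<beta>))) = R"
    using m by (simp add: field_simps)
  then show ?thesis by (simp add: R_def S_def \<alpha>_def \<beta>_def \<gamma>_def)
qed

text \<open>In the isosceles case the corrections with factor \<open>m2 / (m1 + m2)\<close> in
  \<open>weighted_balance\<close> and in its mirror image are opposite. They cancel in
  \<open>g + h\<close>, and the three-body elimination applies unchanged.\<close>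

lemma hinge_distance_constant_on: "r constant_on I"
proof (cases "b = e \<and> c = f")
  case False
  then show ?thesis using constant_or_isosceles by blast
next
  case True
  interpret swap: four_body_hinge I u w v u1 w1 v1 u2 w2 v2 r m1 m2 m4 m3 a c b f e A C B F E
    by (rule swap)
  \<comment> \<open>The mirrored locale defines its own rate with \<open>v\<close> and
    \<open>w\<close> exchanged; both differences change sign, so the product is the same.\<close>
  have \<rho>: "swap.\<rho> t = \<rho> t" for t
    by (simp add: \<rho>_def swap.\<rho>_def inner_diff_left inner_diff_right)
  show ?thesis
  proof (rule hinge_constant_on[OF I(2) r' r_pos])
    show "B \<noteq> 0" "C \<noteq> 0" using pos by (simp_all add: inv_cubes)
    fix t assume t: "t \<in> I"
    define g where "g = v1 t \<bullet> w t + m2 / (m1 + m2) * (u1 t \<bullet> v t - u1 t \<bullet> w t)"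
    define h where "h = w1 t \<bullet> v t + m2 / (m1 + m2) * (u1 t \<bullet> w t - u1 t \<bullet> v t)"
    have "g + h = - r t * \<rho> t"
      using velocity_inner_products(5)[OF t] by (simp add: g_def h_def algebra_simps)
    moreover have "2 * ((1 / r t ^ 3 - C) * g) = \<rho> t * hinge_rate C (b ^ 2 - c ^ 2) (r t)"
      using weighted_balance[OF _ _ t] True unfolding g_def by blast
    moreover have "2 * ((1 / r t ^ 3 - B) * h) = \<rho> t * hinge_rate B (- (b ^ 2 - c ^ 2)) (r t)"
      using swap.weighted_balance[OF _ _ t] True unfolding h_def \<rho> by simp
    ultimately show "\<exists>g h. g + h = - r t * \<rho> t \<and>
      2 * ((1 / r t ^ 3 - C) * g) = \<rho> t * hinge_rate C (b ^ 2 - c ^ 2) (r t) \<and>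
      2 * ((1 / r t ^ 3 - B) * h) = \<rho> t * hinge_rate B (- (b ^ 2 - c ^ 2)) (r t)"
      by blast
  qed
qed

end

section \<open>From solutions in absolute coordinates to relative coordinates\<close>

lemma n_body_solution_velocity:
  assumes "open I" "n_body_solution n m I X"
  obtains V where "\<And>j t. j \<in> {1..n} \<Longrightarrow> t \<in> I \<Longrightarrow> (X j has_vector_derivative V j t) (at t)"
    and "\<And>j t. j \<in> {1..n} \<Longrightarrow> t \<in> I \<Longrightarrow>
      (V j has_vector_derivative newton_acceleration n m X j t) (at t)"
    and "\<And>i j t. i \<in> {1..n} \<Longrightarrow> j \<in> {1..n} \<Longrightarrow> i \<noteq> j \<Longrightarrow> t \<in> I \<Longrightarrow> X i t \<noteq> X j t"
proof -
  obtain V where "\<forall>j\<in>{1..n}. \<forall>t\<in>I. (X j has_vector_derivative V j t) (at t within I) \<and>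
      (V j has_vector_derivative newton_acceleration n m X j t) (at t within I)"
    using assms(2) unfolding n_body_solution_def by blast
  moreover have "at t within I = at t" if "t \<in> I" for t
    using at_within_open[OF that assms(1)] .
  moreover have "X i t \<noteq> X j t" if "i \<in> {1..n}" "j \<in> {1..n}" "i \<noteq> j" "t \<in> I" for i j t
    using assms(2) that unfolding n_body_solution_def mutual_dist_def by fastforce
  ultimately show thesis using that[of V] by auto
qed

lemma mutual_dist_commute: "mutual_dist X i j = mutual_dist X j i"
  by (simp add: mutual_dist_def norm_minus_commute fun_eq_iff)

lemma constant_mutual_dist:
  assumes "mutual_dist X i j constant_on I" "I \<noteq> {}" "\<And>t. t \<in> I \<Longrightarrow> X i t \<noteq> X j t"
  obtains k where "k > 0" "\<And>t. t \<in> I \<Longrightarrow> norm (X i t - X j t) = k"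
    "\<And>t. t \<in> I \<Longrightarrow> norm (X j t - X i t) = k"
proof -
  obtain k where k: "\<And>t. t \<in> I \<Longrightarrow> norm (X i t - X j t) = k"
    using assms(1) unfolding constant_on_def mutual_dist_def by blast
  moreover have "k > 0"
  proof -
    obtain t where "t \<in> I" using assms(2) by blast
    then show ?thesis using k[of t] assms(3)[of t] by auto
  qed
  ultimately show thesis using that[of k] by (simp add: norm_minus_commute)
qed

text \<open>Any labelling of the bodies is allowed, so that \<open>j\<close>, \<open>k\<close> can
  be any possible hinge. The third body \<open>i\<close> serves as origin.\<close>

lemma three_body_no_hinge:
  fixes X :: "nat \<Rightarrow> real \<Rightarrow> real ^ 'd"
  assumes I: "open I" "is_interval I" "I \<noteq> {}"
    and m: "\<forall>i\<in>{1..3}. m i > 0" and sol: "n_body_solution 3 m I X"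
    and bodies: "{1..3} = {i, j, k}" "distinct [i, j, k]"
    and const: "mutual_dist X i j constant_on I" "mutual_dist X i k constant_on I"
  shows "mutual_dist X j k constant_on I"
proof -
  obtain V where V: "\<And>j t. j \<in> {1..3} \<Longrightarrow> t \<in> I \<Longrightarrow> (X j has_vector_derivative V j t) (at t)"
    and V': "\<And>j t. j \<in> {1..3} \<Longrightarrow> t \<in> I \<Longrightarrow>
      (V j has_vector_derivative newton_acceleration 3 m X j t) (at t)"
    and neq: "\<And>i j t. i \<in> {1..3} \<Longrightarrow> j \<in> {1..3} \<Longrightarrow> i \<noteq> j \<Longrightarrow> t \<in> I \<Longrightarrow> X i t \<noteq> X j t"
    by (rule n_body_solution_velocity[OF I(1) sol]) (rule that)
  have mem: "i \<in> {1..3}" "j \<in> {1..3}" "k \<in> {1..3}" unfolding bodies(1) by auto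
  obtain b where b: "b > 0" "\<And>t. t \<in> I \<Longrightarrow> norm (X i t - X j t) = b"
      "\<And>t. t \<in> I \<Longrightarrow> norm (X j t - X i t) = b"
    using constant_mutual_dist[OF const(1) I(3) neq] mem bodies(2) by auto
  obtain c where c: "c > 0" "\<And>t. t \<in> I \<Longrightarrow> norm (X i t - X k t) = c"
      "\<And>t. t \<in> I \<Longrightarrow> norm (X k t - X i t) = c"
    using constant_mutual_dist[OF const(2) I(3) neq] mem bodies(2) by auto
  have others: "{i, j, k} - {i} = {j, k}" "{i, j, k} - {j} = {i, k}" "{i, j, k} - {k} = {i, j}"
    using bodies(2) by auto
  have "(\<lambda>t. norm ((X j t - X i t) - (X k t - X i t))) constant_on I"
  proof (rule three_body_hinge_constant_on[OF I(1,2)])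
    fix t assume t: "t \<in> I"
    show "((\<lambda>t. X j t - X i t) has_vector_derivative V j t - V i t) (at t)"
      "((\<lambda>t. X k t - X i t) has_vector_derivative V k t - V i t) (at t)"
      using t mem by (auto intro!: derivative_intros V)
    show "((\<lambda>t. V j t - V i t) has_vector_derivative
        newton_acceleration 3 m X j t - newton_acceleration 3 m X i t) (at t)"
      "((\<lambda>t. V k t - V i t) has_vector_derivative
        newton_acceleration 3 m X k t - newton_acceleration 3 m X i t) (at t)"
      using t mem by (auto intro!: derivative_intros V')
    show "X j t - X i t \<noteq> X k t - X i t" using neq[OF mem(2,3) _ t] bodies(2) by simp
    show "newton_acceleration 3 m X j t - newton_acceleration 3 m X i t
      = - ((m i + m j) / b ^ 3) *\<^sub>R (X j t - X i t)
        + m k *\<^sub>R ((1 / norm ((X j t - X i t) - (X k t - X i t)) ^ 3) *\<^sub>R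
            ((X k t - X i t) - (X j t - X i t)) - (1 / c ^ 3) *\<^sub>R (X k t - X i t))"
      unfolding newton_acceleration_def bodies(1) others using t bodies(2)
      by (simp add: mutual_dist_def b(2,3) c(2,3)
        norm_minus_commute[of "X k t" "X j t"] add_divide_distrib algebra_simps)
    show "newton_acceleration 3 m X k t - newton_acceleration 3 m X i t
      = - ((m i + m k) / c ^ 3) *\<^sub>R (X k t - X i t)
        + m j *\<^sub>R ((1 / norm ((X j t - X i t) - (X k t - X i t)) ^ 3) *\<^sub>R
            ((X j t - X i t) - (X k t - X i t)) - (1 / b ^ 3) *\<^sub>R (X j t - X i t))"
      unfolding newton_acceleration_def bodies(1) others using t bodies(2)
      by (simp add: mutual_dist_def b(2,3) c(2,3)
        norm_minus_commute[of "X k t" "X j t"] add_divide_distrib algebra_simps)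
  qed (use b c m mem in auto)
  then show ?thesis by (simp add: mutual_dist_def[abs_def])
qed

text \<open>As for three bodies, the hinge is \<open>k\<close>, \<open>l\<close> in an arbitrary
  labelling. Subtracting the acceleration of body \<open>i\<close> from Newton's equations yields
  the locale assumptions.\<close>

lemma four_body_no_hinge:
  fixes X :: "nat \<Rightarrow> real \<Rightarrow> real ^ 'd"
  assumes I: "open I" "is_interval I" "I \<noteq> {}"
    and m: "\<forall>i\<in>{1..4}. m i > 0" and sol: "n_body_solution 4 m I X"
    and bodies: "{1..4} = {i, j, k, l}" "distinct [i, j, k, l]"
    and const: "mutual_dist X i j constant_on I" "mutual_dist X i k constant_on I"
      "mutual_dist X i l constant_on I" "mutual_dist X j k constant_on I"
      "mutual_dist X j l constant_on I"
  shows "mutual_dist X k l constant_on I"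
proof -
  obtain V where V: "\<And>j t. j \<in> {1..4} \<Longrightarrow> t \<in> I \<Longrightarrow> (X j has_vector_derivative V j t) (at t)"
    and V': "\<And>j t. j \<in> {1..4} \<Longrightarrow> t \<in> I \<Longrightarrow>
      (V j has_vector_derivative newton_acceleration 4 m X j t) (at t)"
    and neq: "\<And>i j t. i \<in> {1..4} \<Longrightarrow> j \<in> {1..4} \<Longrightarrow> i \<noteq> j \<Longrightarrow> t \<in> I \<Longrightarrow> X i t \<noteq> X j t"
    by (rule n_body_solution_velocity[OF I(1) sol]) (rule that)
  have mem: "i \<in> {1..4}" "j \<in> {1..4}" "k \<in> {1..4}" "l \<in> {1..4}" unfolding bodies(1) by auto
  obtain a where a: "a > 0" "\<And>t. t \<in> I \<Longrightarrow> norm (X i t - X j t) = a"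
      "\<And>t. t \<in> I \<Longrightarrow> norm (X j t - X i t) = a"
    using constant_mutual_dist[OF const(1) I(3) neq] mem bodies(2) by auto
  obtain b where b: "b > 0" "\<And>t. t \<in> I \<Longrightarrow> norm (X i t - X k t) = b"
      "\<And>t. t \<in> I \<Longrightarrow> norm (X k t - X i t) = b"
    using constant_mutual_dist[OF const(2) I(3) neq] mem bodies(2) by auto
  obtain c where c: "c > 0" "\<And>t. t \<in> I \<Longrightarrow> norm (X i t - X l t) = c"
      "\<And>t. t \<in> I \<Longrightarrow> norm (X l t - X i t) = c"
    using constant_mutual_dist[OF const(3) I(3) neq] mem bodies(2) by auto
  obtain e where e: "e > 0" "\<And>t. t \<in> I \<Longrightarrow> norm (X j t - X k t) = e"
      "\<And>t. t \<in> I \<Longrightarrow> norm (X k t - X j t) = e"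
    using constant_mutual_dist[OF const(4) I(3) neq] mem bodies(2) by auto
  obtain f where f: "f > 0" "\<And>t. t \<in> I \<Longrightarrow> norm (X j t - X l t) = f"
      "\<And>t. t \<in> I \<Longrightarrow> norm (X l t - X j t) = f"
    using constant_mutual_dist[OF const(5) I(3) neq] mem bodies(2) by auto
  define acc where "acc = newton_acceleration 4 m X"
  have others: "{i, j, k, l} - {i} = {j, k, l}" "{i, j, k, l} - {j} = {i, k, l}"
    "{i, j, k, l} - {k} = {i, j, l}" "{i, j, k, l} - {l} = {i, j, k}"
    using bodies(2) by auto
  interpret four_body_hinge I "\<lambda>t. X j t - X i t" "\<lambda>t. X k t - X i t" "\<lambda>t. X l t - X i t"
    "\<lambda>t. V j t - V i t" "\<lambda>t. V k t - V i t" "\<lambda>t. V l t - V i t"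
    "\<lambda>t. acc j t - acc i t" "\<lambda>t. acc k t - acc i t" "\<lambda>t. acc l t - acc i t"
    "mutual_dist X k l" "m i" "m j" "m k" "m l" a b c e f
    "1 / a ^ 3" "1 / b ^ 3" "1 / c ^ 3" "1 / e ^ 3" "1 / f ^ 3"
  proof
    fix t assume t: "t \<in> I"
    show "((\<lambda>t. X j t - X i t) has_vector_derivative V j t - V i t) (at t)"
      "((\<lambda>t. X k t - X i t) has_vector_derivative V k t - V i t) (at t)"
      "((\<lambda>t. X l t - X i t) has_vector_derivative V l t - V i t) (at t)"
      using t mem by (auto intro!: derivative_intros V)
    show "((\<lambda>t. V j t - V i t) has_vector_derivative acc j t - acc i t) (at t)"
      "((\<lambda>t. V k t - V i t) has_vector_derivative acc k t - acc i t) (at t)"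
      "((\<lambda>t. V l t - V i t) has_vector_derivative acc l t - acc i t) (at t)"
      unfolding acc_def using t mem by (auto intro!: derivative_intros V')
    show "mutual_dist X k l t > 0"
      using neq[OF mem(3,4) _ t] bodies(2) by (simp add: mutual_dist_def)
    note acc_simps = mutual_dist_def a(2,3) b(2,3) c(2,3) e(2,3) f(2,3) norm_minus_commute[of "X l t" "X k t"]
      add_divide_distrib algebra_simps
    show "acc j t - acc i t = - ((m i + m j) * (1 / a ^ 3)) *\<^sub>R (X j t - X i t)
      + m k *\<^sub>R ((1 / e ^ 3) *\<^sub>R (X k t - X i t - (X j t - X i t)) - (1 / b ^ 3) *\<^sub>R (X k t - X i t))
      + m l *\<^sub>R ((1 / f ^ 3) *\<^sub>R (X l t - X i t - (X j t - X i t)) - (1 / c ^ 3) *\<^sub>R (X l t - X i t))"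
      unfolding acc_def newton_acceleration_def bodies(1) others using t bodies(2)
      by (simp add: acc_simps)
    show "acc k t - acc i t = - ((m i + m k) * (1 / b ^ 3)) *\<^sub>R (X k t - X i t)
      + m j *\<^sub>R ((1 / e ^ 3) *\<^sub>R (X j t - X i t - (X k t - X i t)) - (1 / a ^ 3) *\<^sub>R (X j t - X i t))
      + m l *\<^sub>R ((1 / mutual_dist X k l t ^ 3) *\<^sub>R (X l t - X i t - (X k t - X i t))
        - (1 / c ^ 3) *\<^sub>R (X l t - X i t))"
      unfolding acc_def newton_acceleration_def bodies(1) others using t bodies(2)
      by (simp add: acc_simps)
    show "acc l t - acc i t = - ((m i + m l) * (1 / c ^ 3)) *\<^sub>R (X l t - X i t)
      + m j *\<^sub>R ((1 / f ^ 3) *\<^sub>R (X j t - X i t - (X l t - X i t)) - (1 / a ^ 3) *\<^sub>R (X j t - X i t))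
      + m k *\<^sub>R ((1 / mutual_dist X k l t ^ 3) *\<^sub>R (X k t - X i t - (X l t - X i t))
        - (1 / b ^ 3) *\<^sub>R (X k t - X i t))"
      unfolding acc_def newton_acceleration_def bodies(1) others using t bodies(2)
      by (simp add: acc_simps)
  qed (use I a b c e f m mem in \<open>auto simp: mutual_dist_def\<close>)
  show ?thesis by (rule hinge_distance_constant_on)
qed

section \<open>Choice of the labelling and the final count of distances\<close>

text \<open>Passes from the ordered index pairs of \<open>pairs\<close> to unordered ones, so that
  the bodies can be relabelled freely.\<close>

lemma hingedE:
  assumes "hinged n m I X"
  obtains k l where "k \<in> {1..n}" "l \<in> {1..n}" "k \<noteq> l" "\<not> mutual_dist X k l constant_on I"
    and "\<And>i j. i \<in> {1..n} \<Longrightarrow> j \<in> {1..n} \<Longrightarrow> i \<noteq> j \<Longrightarrow> {i, j} \<noteq> {k, l} \<Longrightarrow>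
      mutual_dist X i j constant_on I"
proof -
  obtain k l where kl: "(k, l) \<in> pairs n" "\<not> mutual_dist X k l constant_on I"
    and const: "\<And>i j. (i, j) \<in> pairs n \<Longrightarrow> (i, j) \<noteq> (k, l) \<Longrightarrow> mutual_dist X i j constant_on I"
    using assms unfolding hinged_def by blast
  have "mutual_dist X i j constant_on I"
    if "i \<in> {1..n}" "j \<in> {1..n}" "i \<noteq> j" "{i, j} \<noteq> {k, l}" for i j
  proof (cases "i < j")
    case True
    then show ?thesis using const[of i j] that by (auto simp: pairs_def)
  next
    case False
    then show ?thesis
      using const[of j i] that by (auto simp: pairs_def mutual_dist_commute[of X i j] insert_commute)
  qed
  then show thesis using that[of k l] kl by (auto simp: pairs_def)
qed

lemma not_hinged_3:
  fixes X :: "nat \<Rightarrow> real \<Rightarrow> real ^ 'd"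
  assumes I: "open I" "is_interval I" "I \<noteq> {}" and m: "\<forall>i\<in>{1..3}. m i > 0"
  shows "\<not> hinged 3 m I X"
proof
  assume "hinged 3 m I X"
  then have sol: "n_body_solution 3 m I X" by (simp add: hinged_def)
  from \<open>hinged 3 m I X\<close> obtain k l where kl: "k \<in> {1..3}" "l \<in> {1..3}" "k \<noteq> l" "\<not> mutual_dist X k l constant_on I"
    and const: "\<And>i j. i \<in> {1..3} \<Longrightarrow> j \<in> {1..3} \<Longrightarrow> i \<noteq> j \<Longrightarrow> {i, j} \<noteq> {k, l} \<Longrightarrow>
      mutual_dist X i j constant_on I"
    by (rule hingedE) (rule that)
  have "card ({1..3} - {k, l}) = 1"
    using kl by (simp add: card_Diff_subset)
  then obtain i where i: "{1..3} - {k, l} = {i}" by (meson card_1_singletonE)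
  then have "i \<in> {1..3} - {k, l}" by blast
  then have i': "distinct [i, k, l]" "i \<in> {1..3}" using kl(3) by simp_all
  have "{1..3} = {i, k, l}" using i kl(1,2) by blast
  then have "mutual_dist X k l constant_on I"
    by (rule three_body_no_hinge[OF I m sol _ i'(1)])
      (use i' kl in \<open>auto intro!: const simp: doubleton_eq_iff\<close>)
  with kl show False by simp
qed

lemma not_hinged_4:
  fixes X :: "nat \<Rightarrow> real \<Rightarrow> real ^ 'd"
  assumes I: "open I" "is_interval I" "I \<noteq> {}" and m: "\<forall>i\<in>{1..4}. m i > 0"
  shows "\<not> hinged 4 m I X"
proof
  assume "hinged 4 m I X"
  then have sol: "n_body_solution 4 m I X" by (simp add: hinged_def)
  from \<open>hinged 4 m I X\<close> obtain k l where kl: "k \<in> {1..4}" "l \<in> {1..4}" "k \<noteq> l" "\<not> mutual_dist X k l constant_on I"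
    and const: "\<And>i j. i \<in> {1..4} \<Longrightarrow> j \<in> {1..4} \<Longrightarrow> i \<noteq> j \<Longrightarrow> {i, j} \<noteq> {k, l} \<Longrightarrow>
      mutual_dist X i j constant_on I"
    by (rule hingedE) (rule that)
  have "card ({1..4} - {k, l}) = 2"
    using kl by (simp add: card_Diff_subset)
  then obtain i j where ij: "{1..4} - {k, l} = {i, j}" "i \<noteq> j" by (meson card_2_iff)
  then have "i \<in> {1..4} - {k, l}" "j \<in> {1..4} - {k, l}" by blast+
  then have ij': "distinct [i, j, k, l]" "i \<in> {1..4}" "j \<in> {1..4}"
    using kl(3) ij(2) by simp_all
  have "{1..4} = {i, j, k, l}" using ij(1) kl(1,2) by blast
  then have "mutual_dist X k l constant_on I"
    by (rule four_body_no_hinge[OF I m sol _ ij'(1)])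
      (use ij' kl in \<open>auto intro!: const simp: doubleton_eq_iff\<close>)
  with kl show False by simp
qed

text \<open>Exactly one pair lies outside \<open>S\<close>. If its distance varied, the solution
  would be hinged.\<close>

lemma relative_equilibrium_if_not_hinged:
  assumes "\<not> hinged n m I X" "n_body_solution n m I X"
    and S: "S \<subseteq> pairs n" "Suc (card S) = card (pairs n)"
    and const: "\<forall>(i, j)\<in>S. mutual_dist X i j constant_on I"
  shows "relative_equilibrium n m I X"
proof -
  have fin: "finite (pairs n)"
    by (rule finite_subset[of _ "{1..n} \<times> {1..n}"]) (auto simp: pairs_def)
  then have "card (pairs n - S) = 1"
    using S by (simp add: card_Diff_subset finite_subset)
  then obtain k l where kl: "pairs n - S = {(k, l)}"
    by (metis card_1_singletonE surj_pair)
  then have "S = pairs n - {(k, l)}" "(k, l) \<in> pairs n" using S(1) by auto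
  then show ?thesis
    using assms unfolding hinged_def relative_equilibrium_def by blast
qed

theorem mainTheorem1:
  fixes I :: "real set"
    and m :: "nat \<Rightarrow> real"
    and X :: "nat \<Rightarrow> real \<Rightarrow> real ^ 'd"
  assumes "open I" and "is_interval I" and "I \<noteq> {}"
  shows "((\<forall>i\<in>{1..3}. m i > 0) \<longrightarrow>
            \<not> hinged 3 m I X \<and>
            (n_body_solution 3 m I X \<and>
             (\<exists>S \<subseteq> pairs 3. card S = 2 \<and> (\<forall>(i, j)\<in>S. mutual_dist X i j constant_on I))
             \<longrightarrow> relative_equilibrium 3 m I X)) \<and>
         ((\<forall>i\<in>{1..4}. m i > 0) \<longrightarrow>
            \<not> hinged 4 m I X \<and>
            (n_body_solution 4 m I X \<and>
             (\<exists>S \<subseteq> pairs 4. card S = 5 \<and> (\<forall>(i, j)\<in>S. mutual_dist X i j constant_on I))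
             \<longrightarrow> relative_equilibrium 4 m I X))"
proof -
  have "pairs 3 = {(1, 2), (1, 3), (2, 3)}"
    and "pairs 4 = {(1, 2), (1, 3), (1, 4), (2, 3), (2, 4), (3, 4)}"
    by (auto simp: pairs_def)
  \<comment> \<open>The totals 3 and 6 are written as successors to match the cardinality premise of
    \<open>relative_equilibrium_if_not_hinged\<close>.\<close>
  then have "card (pairs 3) = Suc 2" "card (pairs 4) = Suc 5" by simp_all
  then show ?thesis
    using not_hinged_3[OF assms] not_hinged_4[OF assms]
      relative_equilibrium_if_not_hinged[of 3 m I X] relative_equilibrium_if_not_hinged[of 4 m I X]
    by metis
qed

end
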